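(* Let $A$ be a Latin square of order $n$. If $n$ is odd, then the maximum number of mutually orthogonal Latin squares of order $n$ in the set $D_8(A)$ is less than or equal to $4$. If $n$ is even, then the maximum number of mutually orthogonal Latin squares in the set $D_8(A)$ is $2$.
   Context: A Latin square of order $n$ is an $n\times n$ array with entries in $\{1,\dots,n\}$ in which each symbol occurs exactly once in each row and each column. Two Latin squares $(a_{ij})$, $(b_{ij})$ of order $n$ are orthogonal if the $n^2$ ordered pairs $(a_{ij},b_{ij})$ are all distinct. A set of Latin squares is mutually orthogonal if any two distinct members are orthogonal. For $A=(a_{ij})$ of order $n$ the dihedral group $D_8=\{r_0,r_1,r_2,r_3,s_0,s_1,s_2,s_3\}$ acts by (the displayed expression is the $(i,j)$ entry): $r_0(A)=(a_{ij})$, $r_1(A)=(a_{j(n+1-i)})$, $r_2(A)=(a_{(n+1-i)(n+1-j)})$, $r_3(A)=(a_{(n+1-j)i})$, $s_0(A)=(a_{(n+1-i)j})$, $s_1(A)=(a_{ji})$, $s_2(A)=(a_{i(n+1-j)})$, $s_3(A)=(a_{(n+1-j)(n+1-i)})$. The set $D_8(A)$ is $\{A,r_1(A),r_2(A),r_3(A),s_0(A),s_1(A),s_2(A),s_3(A)\}$. "The maximum number of mutually orthogonal Latin squares in $D_8(A)$" is the largest size of a mutually orthogonal subset of $D_8(A)$.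
   Formalization: For even n the maximum is proved to be at most 2, equal to 2 whenever D_8(A) contains two distinct orthogonal squares, and 2 for some A of positive even order; equality for every A is false (for n = 2 the maximum is 1). *)

theory Defs
  imports Main "HOL-Library.FuncSet"
begin

text \<open>
  Arrays of order \<open>n\<close> are extensional functions on \<open>{1..n} \<times> {1..n}\<close>, i.e. they take the value
  \<open>undefined\<close> elsewhere. Hence two arrays of order \<open>n\<close> are equal in HOL iff they have the same
  entries, and cardinalities of sets of arrays are the intended ones.
\<close>

type_synonym array = "nat \<times> nat \<Rightarrow> nat"

definition cells :: "nat \<Rightarrow> (nat \<times> nat) set" where
  "cells n = {1..n} \<times> {1..n}"

definition latin_square :: "nat \<Rightarrow> array \<Rightarrow> bool" where
  "latin_square n A \<longleftrightarrow>
     A \<in> cells n \<rightarrow>\<^sub>E {1..n} \<and>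
     (\<forall>i\<in>{1..n}. \<forall>k\<in>{1..n}. \<exists>!j. j \<in> {1..n} \<and> A (i, j) = k) \<and>
     (\<forall>j\<in>{1..n}. \<forall>k\<in>{1..n}. \<exists>!i. i \<in> {1..n} \<and> A (i, j) = k)"

definition orthogonal :: "nat \<Rightarrow> array \<Rightarrow> array \<Rightarrow> bool" where
  "orthogonal n A B \<longleftrightarrow> inj_on (\<lambda>p. (A p, B p)) (cells n)"

text \<open>The empty set and all singletons of Latin squares are (vacuously) mutually orthogonal.\<close>

definition mutually_orthogonal :: "nat \<Rightarrow> array set \<Rightarrow> bool" where
  "mutually_orthogonal n S \<longleftrightarrow> (\<forall>A\<in>S. latin_square n A) \<and> pairwise (orthogonal n) S"

definition r0 :: "nat \<Rightarrow> array \<Rightarrow> array" where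
  "r0 n A = (\<lambda>(i, j)\<in>cells n. A (i, j))"

definition r1 :: "nat \<Rightarrow> array \<Rightarrow> array" where
  "r1 n A = (\<lambda>(i, j)\<in>cells n. A (j, n + 1 - i))"

definition r2 :: "nat \<Rightarrow> array \<Rightarrow> array" where
  "r2 n A = (\<lambda>(i, j)\<in>cells n. A (n + 1 - i, n + 1 - j))"

definition r3 :: "nat \<Rightarrow> array \<Rightarrow> array" where
  "r3 n A = (\<lambda>(i, j)\<in>cells n. A (n + 1 - j, i))"

definition s0 :: "nat \<Rightarrow> array \<Rightarrow> array" where
  "s0 n A = (\<lambda>(i, j)\<in>cells n. A (n + 1 - i, j))"

definition s1 :: "nat \<Rightarrow> array \<Rightarrow> array" where
  "s1 n A = (\<lambda>(i, j)\<in>cells n. A (j, i))"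

definition s2 :: "nat \<Rightarrow> array \<Rightarrow> array" where
  "s2 n A = (\<lambda>(i, j)\<in>cells n. A (i, n + 1 - j))"

definition s3 :: "nat \<Rightarrow> array \<Rightarrow> array" where
  "s3 n A = (\<lambda>(i, j)\<in>cells n. A (n + 1 - j, n + 1 - i))"

definition D8 :: "nat \<Rightarrow> array \<Rightarrow> array set" where
  "D8 n A = {r0 n A, r1 n A, r2 n A, r3 n A, s0 n A, s1 n A, s2 n A, s3 n A}"

text \<open>\<open>D8 n A\<close> is finite, so this is the maximum of a finite set; the set contains 0 because of
  \<open>S = {}\<close>.\<close>

definition max_mols_D8 :: "nat \<Rightarrow> array \<Rightarrow> nat" where
  "max_mols_D8 n A = Max {card S | S. S \<subseteq> D8 n A \<and> mutually_orthogonal n S}"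

end

theory Submission imports Defs begin

text \<open>
  If \<open>A\<close> is orthogonal to its composition with an involution \<open>g\<close> of the cells, every pair
  \<open>(k, k)\<close> occurs exactly once; as it occurs at \<open>p\<close> iff it occurs at \<open>g p\<close>, the cell where
  it occurs is fixed by \<open>g\<close>. So \<open>g\<close> has at least \<open>n\<close> fixed points. The half turn has at most one, and for even
  \<open>n\<close> neither it nor the horizontal and vertical reflections have any. Hence a mutually
  orthogonal subset meets each of the four cosets of \<open>{r\<^sub>0, r\<^sub>2}\<close> at most once, and, for even
  \<open>n\<close>, each of the two cosets of \<open>{r\<^sub>0, r\<^sub>2, s\<^sub>0, s\<^sub>2}\<close>. (For \<open>n \<le> 1\<close> the set \<open>D\<^sub>8(A)\<close> is a singleton.)
\<close>

lemmas D8_element_defs = r0_def r1_def r2_def r3_def s0_def s1_def s2_def s3_def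

section \<open>Fixed cells of an involution\<close>

lemma order_le_card_fixed_points:
  assumes A: "A \<in> cells n \<rightarrow> {1..n}"
    and g: "\<And>p. p \<in> cells n \<Longrightarrow> g p \<in> cells n" "\<And>p. p \<in> cells n \<Longrightarrow> g (g p) = p"
    and B: "\<And>p. p \<in> cells n \<Longrightarrow> B p = A (g p)"
    and "orthogonal n A B"
  shows "n \<le> card {p \<in> cells n. g p = p}"
proof -
  let ?f = "\<lambda>p. (A p, B p)"
  have inj: "inj_on ?f (cells n)"
    using \<open>orthogonal n A B\<close> by (simp add: orthogonal_def)
  have "?f ` cells n \<subseteq> cells n"
    using A g(1) B by (auto simp: cells_def)
  then have onto: "?f ` cells n = cells n"
    using inj by (simp add: endo_inj_surj cells_def)
  have "{1..n} \<subseteq> A ` {p \<in> cells n. g p = p}"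
  proof
    fix k assume "k \<in> {1..n}"
    then have "(k, k) \<in> ?f ` cells n"
      unfolding onto by (simp add: cells_def)
    then obtain p where p: "p \<in> cells n" "A p = k" "B p = k"
      by auto
    have "?f (g p) = ?f p"
      using p B[of p] B[of "g p"] g by simp
    then have "g p = p"
      using inj p(1) g(1) by (meson inj_onD)
    then show "k \<in> A ` {p \<in> cells n. g p = p}"
      using p by auto
  qed
  then have "card {1..n} \<le> card {p \<in> cells n. g p = p}"
    by (rule surj_card_le[rotated]) (simp add: cells_def)
  then show ?thesis by simp
qed

section \<open>The dihedral action on Latin squares\<close>

lemma latin_squareD: "latin_square n A \<Longrightarrow> A \<in> cells n \<rightarrow> {1..n}"
  by (auto simp: latin_square_def)

lemma orthogonal_sym: "orthogonal n A B \<Longrightarrow> orthogonal n B A"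
  by (auto simp: orthogonal_def inj_on_def)

lemma r0_eq: "latin_square n A \<Longrightarrow> r0 n A = A"
  by (auto simp: r0_def latin_square_def PiE_def extensional_def)

lemma latin_square_s1:
  assumes "latin_square n A"
  shows "latin_square n (s1 n A)"
  using assms unfolding latin_square_def s1_def
  by (auto simp: cells_def PiE_iff cong: conj_cong)

lemma latin_square_s0:
  assumes "latin_square n A"
  shows "latin_square n (s0 n A)"
  unfolding latin_square_def
proof (intro conjI ballI)
  show "s0 n A \<in> cells n \<rightarrow>\<^sub>E {1..n}"
    using latin_squareD[OF assms] by (fastforce simp: s0_def cells_def Pi_iff)
next
  fix i k assume "i \<in> {1..n}" "k \<in> {1..n}"
  moreover from this have "n + 1 - i \<in> {1..n}" by auto
  ultimately have "\<exists>!j. j \<in> {1..n} \<and> A (n + 1 - i, j) = k"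
    using assms unfolding latin_square_def by blast
  then show "\<exists>!j. j \<in> {1..n} \<and> s0 n A (i, j) = k"
    using \<open>i \<in> {1..n}\<close> by (simp add: s0_def cells_def cong: conj_cong)
next
  fix j k assume jk: "j \<in> {1..n}" "k \<in> {1..n}"
  then have "\<exists>!i. i \<in> {1..n} \<and> A (i, j) = k"
    using assms unfolding latin_square_def by blast
  then obtain i where i: "i \<in> {1..n}" "A (i, j) = k"
    and uniq: "\<And>i'. i' \<in> {1..n} \<Longrightarrow> A (i', j) = k \<Longrightarrow> i' = i"
    by (elim ex1E) metis
  show "\<exists>!i. i \<in> {1..n} \<and> s0 n A (i, j) = k"
  proof (rule ex1I[of _ "n + 1 - i"])
    show "n + 1 - i \<in> {1..n} \<and> s0 n A (n + 1 - i, j) = k"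
      using i jk by (auto simp: s0_def cells_def)
  next
    fix i' assume i': "i' \<in> {1..n} \<and> s0 n A (i', j) = k"
    then have "n + 1 - i' = i"
      using jk by (intro uniq) (auto simp: s0_def cells_def)
    then show "i' = n + 1 - i"
      using i' by auto
  qed
qed

text \<open>The reflections \<open>s0\<close> and \<open>s1\<close> generate the dihedral group, so
  closure of Latin squares under these two suffices.\<close>

lemma s2_conv: "s2 n A = s1 n (s0 n (s1 n A))"
  and r2_conv: "r2 n A = s0 n (s2 n A)"
  and r1_conv: "r1 n A = s0 n (s1 n A)"
  and r3_conv: "r3 n A = s2 n (s1 n A)"
  and s3_conv: "s3 n A = r2 n (s1 n A)"
  by (auto simp: D8_element_defs cells_def fun_eq_iff)

lemma latin_square_D8:
  assumes "latin_square n A" "B \<in> D8 n A"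
  shows "latin_square n B"
  using assms
  by (auto simp: D8_def r0_eq r1_conv r2_conv r3_conv s2_conv s3_conv
      intro!: latin_square_s0 latin_square_s1)

text \<open>The Klein four-group \<open>{r0, r2, s0, s2}\<close> has index 2; its other coset
  \<open>{s1, r3, r1, s3}\<close> is represented by \<open>s1\<close>.\<close>

lemma D8_eq_cosets:
  assumes "latin_square n A"
  shows "D8 n A = (\<Union>X\<in>{A, s1 n A}. {X, r2 n X, s0 n X, s2 n X})"
  using assms by (auto simp: D8_def r0_eq r1_conv r3_conv s3_conv)

lemma s2_eq_r2_s0: "s2 n A = r2 n (s0 n A)"
  by (auto simp: D8_element_defs cells_def fun_eq_iff)

section \<open>Non-orthogonality inside a coset\<close>

lemma not_orthogonal_r2:
  assumes "latin_square n A" "A \<noteq> r2 n A"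
  shows "\<not> orthogonal n A (r2 n A)"
proof
  assume *: "orthogonal n A (r2 n A)"
  let ?g = "\<lambda>(i, j). (n + 1 - i, n + 1 - j)"
  have "n \<le> card {p \<in> cells n. ?g p = p}"
    by (rule order_le_card_fixed_points[OF latin_squareD[OF assms(1)] _ _ _ *])
      (auto simp: r2_def cells_def)
  \<comment> \<open>A fixed cell satisfies \<open>2 * i = n + 1 = 2 * j\<close>, so only the centre
    qualifies.\<close>
  also have "\<dots> \<le> card {((n + 1) div 2, (n + 1) div 2)}"
    by (rule card_mono) (auto simp: cells_def)
  finally consider "n = 0" | "n = 1"
    by fastforce
  \<comment> \<open>With at most one cell the half turn acts trivially; this contradicts
    \<open>A \<noteq> r2 n A\<close>.\<close>
  then have "r2 n A = r0 n A"
    by cases (auto simp: r2_def r0_def cells_def fun_eq_iff)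
  then show False
    using assms r0_eq by metis
qed

lemma not_orthogonal_even:
  assumes "even n" "X \<in> cells n \<rightarrow>\<^sub>E {1..n}" "Y \<in> extensional (cells n)" "X \<noteq> Y"
    and g: "\<And>p. p \<in> cells n \<Longrightarrow> g p \<in> cells n \<and> g (g p) = p \<and> g p \<noteq> p"
    and Y: "\<And>p. p \<in> cells n \<Longrightarrow> Y p = X (g p)"
  shows "\<not> orthogonal n X Y"
proof
  assume *: "orthogonal n X Y"
  have "n \<le> card {p \<in> cells n. g p = p}"
    using assms by (intro order_le_card_fixed_points[OF _ _ _ _ *]) auto
  also have "{p \<in> cells n. g p = p} = {}"
    using g by blast
  finally have "cells n = {}"
    by (simp add: cells_def)
  \<comment> \<open>Extensional functions on an empty domain coincide, against
    \<open>X \<noteq> Y\<close>.\<close>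
  then show False
    using assms(2-4) by (auto simp: PiE_def extensional_def)
qed

text \<open>Write \<open>Y\<close> and \<open>Z\<close> as \<open>X\<close> composed with
  \<open>h\<close> and \<open>h'\<close> from the Klein four-group. Then \<open>Z\<close> is
  \<open>Y\<close> composed with their product, again an involution, and without fixed cells when
  \<open>n\<close> is even.\<close>

lemma not_orthogonal_coset:
  assumes "even n" "latin_square n X"
    and "Y \<in> {X, r2 n X, s0 n X, s2 n X}" "Z \<in> {X, r2 n X, s0 n X, s2 n X}" "Y \<noteq> Z"
  shows "\<not> orthogonal n Y Z"
proof -
  define K where "K = {\<lambda>p. p, \<lambda>(i, j). (n + 1 - i, n + 1 - j), \<lambda>(i, j). (n + 1 - i, j),
    \<lambda>(i, j). (i, n + 1 - j)}"
  have odd_sum: "Suc n - i \<noteq> i" if "i \<le> n" for i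
    using \<open>even n\<close> that by presburger
  have K: "h p \<in> cells n" "h (h p) = p" if "h \<in> K" "p \<in> cells n" for h p
    using that by (auto simp: K_def cells_def)
  \<comment> \<open>\<open>K\<close> is commutative of exponent 2, so a product of two members is an
    involution.\<close>
  have comp: "h (h' (h (h' p))) = p" if "h \<in> K" "h' \<in> K" "p \<in> cells n" for h h' p
    using that unfolding K_def by (elim insertE emptyE) (auto simp: cells_def)
  have coset: "latin_square n W \<and> (\<exists>h\<in>K. \<forall>p\<in>cells n. W p = X (h p))"
    if "W \<in> {X, r2 n X, s0 n X, s2 n X}" for W
  proof
    show "latin_square n W"
      using that assms(2) by (auto simp: r2_conv s2_conv intro!: latin_square_s0 latin_square_s1)
    show "\<exists>h\<in>K. \<forall>p\<in>cells n. W p = X (h p)"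
      using that by (elim insertE emptyE) (simp_all add: K_def r2_def s0_def s2_def split_beta)
  qed
  then obtain h h' where h: "h \<in> K" "\<And>p. p \<in> cells n \<Longrightarrow> Y p = X (h p)"
    and h': "h' \<in> K" "\<And>p. p \<in> cells n \<Longrightarrow> Z p = X (h' p)"
    using assms(3,4) by metis
  have ext: "Y \<in> cells n \<rightarrow>\<^sub>E {1..n}" "Z \<in> cells n \<rightarrow>\<^sub>E {1..n}"
    using coset assms(3,4) by (auto simp: latin_square_def)
  have "h \<noteq> h'"
    using PiE_ext[OF ext] h h' \<open>Y \<noteq> Z\<close> by metis
  show ?thesis
  proof (rule not_orthogonal_even[where g = "\<lambda>p. h (h' p)", OF \<open>even n\<close> ext(1) _ \<open>Y \<noteq> Z\<close>])
    show "Z \<in> extensional (cells n)"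
      using ext(2) by (simp add: PiE_def)
    fix p assume p: "p \<in> cells n"
    show "Z p = Y (h (h' p))"
      using p K h h' by metis
    from p obtain i j where ij: "p = (i, j)" "i \<le> n" "j \<le> n"
      by (auto simp: cells_def)
    \<comment> \<open>Distinct members of \<open>K\<close> disagree on whether to mirror some
      coordinate, and for even \<open>n\<close> no index is its own mirror image. As
      \<open>h\<close> is an involution, \<open>h (h' p) = p\<close> would force
      \<open>h p = h' p\<close>.\<close>
    have "h p \<noteq> h' p"
      using h(1) h'(1) \<open>h \<noteq> h'\<close> unfolding K_def ij(1)
      by (elim insertE emptyE) (simp_all add: odd_sum ij(2,3) odd_sum[symmetric])
    then show "h (h' p) \<in> cells n \<and> h (h' (h (h' p))) = p \<and> h (h' p) \<noteq> p"
      using comp K h(1) h'(1) p by metis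
  qed
qed

text \<open>Pigeonhole: each block \<open>C X\<close> contains at most one member of
  \<open>S\<close>. Blocks may overlap, so \<open>c\<close> chooses one for each member.\<close>

lemma mutually_orthogonal_card_le:
  assumes S: "mutually_orthogonal n S" "S \<subseteq> (\<Union>X\<in>F. C X)"
    and F: "finite F" "card F \<le> m"
    and C: "\<And>X Y Z. X \<in> F \<Longrightarrow> Y \<in> C X \<Longrightarrow> Z \<in> C X \<Longrightarrow> Y \<noteq> Z \<Longrightarrow> \<not> orthogonal n Y Z"
  shows "card S \<le> m"
proof -
  from S(2) have "\<forall>Y\<in>S. \<exists>X. X \<in> F \<and> Y \<in> C X"
    by blast
  then obtain c where c: "\<And>Y. Y \<in> S \<Longrightarrow> c Y \<in> F \<and> Y \<in> C (c Y)"
    by metis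
  have "inj_on c S"
  proof (rule inj_onI, rule ccontr)
    fix Y Z assume YZ: "Y \<in> S" "Z \<in> S" "c Y = c Z" "Y \<noteq> Z"
    then have "\<not> orthogonal n Y Z"
      using C[of "c Y" Y Z] c[of Y] c[of Z] by simp
    then show False
      using S(1) YZ by (auto simp: mutually_orthogonal_def pairwise_def)
  qed
  then have "card S \<le> card F"
    using c F(1) by (intro card_inj_on_le) auto
  with F(2) show ?thesis by simp
qed

lemma card_le_4_if_mutually_orthogonal:
  assumes "latin_square n A" "S \<subseteq> D8 n A" "mutually_orthogonal n S"
  shows "card S \<le> 4"
proof (rule mutually_orthogonal_card_le[OF assms(3)])
  \<comment> \<open>Representatives of the four cosets of \<open>{r0, r2}\<close>; the last one is
    \<open>r1 n A\<close>.\<close>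
  let ?F = "{A, s0 n A, s1 n A, s0 n (s1 n A)}"
  show "S \<subseteq> (\<Union>X\<in>?F. {X, r2 n X})"
    using assms(2) unfolding D8_eq_cosets[OF assms(1)] by (auto simp: s2_eq_r2_s0)
  show "card ?F \<le> 4"
    using card_length[of "[A, s0 n A, s1 n A, s0 n (s1 n A)]"] by simp
  fix X Y Z
  assume "X \<in> ?F" "Y \<in> {X, r2 n X}" "Z \<in> {X, r2 n X}" "Y \<noteq> Z"
  moreover from \<open>X \<in> ?F\<close> have "latin_square n X"
    using assms(1) by (auto intro!: latin_square_s0 latin_square_s1)
  ultimately show "\<not> orthogonal n Y Z"
    using not_orthogonal_r2[of n X] orthogonal_sym[of n "r2 n X" X]
    by (elim insertE emptyE) metis+
qed simp

lemma card_le_2_if_mutually_orthogonal: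
  assumes "even n" "latin_square n A" "S \<subseteq> D8 n A" "mutually_orthogonal n S"
  shows "card S \<le> 2"
proof (rule mutually_orthogonal_card_le[OF assms(4)])
  show "S \<subseteq> (\<Union>X\<in>{A, s1 n A}. {X, r2 n X, s0 n X, s2 n X})"
    using assms(3) unfolding D8_eq_cosets[OF assms(2)] .
  show "card {A, s1 n A} \<le> 2"
    by (simp add: card_insert_if)
  fix X Y Z
  assume "X \<in> {A, s1 n A}"
    and YZ: "Y \<in> {X, r2 n X, s0 n X, s2 n X}" "Z \<in> {X, r2 n X, s0 n X, s2 n X}" "Y \<noteq> Z"
  then have "latin_square n X"
    using assms(2) latin_square_s1 by blast
  then show "\<not> orthogonal n Y Z"
    using not_orthogonal_coset[OF assms(1) _ YZ] by simp
qed simp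

section \<open>The maximum and its attainment\<close>

lemma finite_card_mols_D8: "finite {card S | S. S \<subseteq> D8 n A \<and> mutually_orthogonal n S}"
proof -
  have "finite (D8 n A)"
    by (simp add: D8_def)
  then show ?thesis
    by simp
qed

lemma max_mols_D8_le:
  assumes "\<And>S. S \<subseteq> D8 n A \<Longrightarrow> mutually_orthogonal n S \<Longrightarrow> card S \<le> m"
  shows "max_mols_D8 n A \<le> m"
proof -
  \<comment> \<open>Bounding \<open>Max\<close> requires a nonempty set of cardinalities.\<close>
  have "card ({} :: array set) \<in> {card S | S. S \<subseteq> D8 n A \<and> mutually_orthogonal n S}"
    by (intro CollectI exI[of _ "{}"]) (simp add: mutually_orthogonal_def)
  then show ?thesis
    unfolding max_mols_D8_def using assms
    by (intro Max.boundedI finite_card_mols_D8) auto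
qed

lemma two_le_max_mols_D8:
  assumes "latin_square n A" "B \<in> D8 n A" "C \<in> D8 n A" "B \<noteq> C" "orthogonal n B C"
  shows "2 \<le> max_mols_D8 n A"
proof -
  have "mutually_orthogonal n {B, C}"
    using assms latin_square_D8 orthogonal_sym
    by (auto simp: mutually_orthogonal_def pairwise_insert)
  then have "card {B, C} \<in> {card S | S. S \<subseteq> D8 n A \<and> mutually_orthogonal n S}"
    using assms by blast
  from Max_ge[OF finite_card_mols_D8 this] show ?thesis
    unfolding max_mols_D8_def using \<open>B \<noteq> C\<close> by simp
qed

text \<open>With 1, 2, 3, 4 standing for 0, 1, w, w^2 in the field of four elements, this is the
  table of w^2 x + w y. It is orthogonal to its transpose because the determinant w^4 - w^2 = 1 is
  nonzero. Order 2 admits no orthogonal pair, so 4 is the least positive even order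
  possible.\<close>

definition self_orthogonal_4 :: array where
  "self_orthogonal_4 = (\<lambda>(i, j)\<in>cells 4.
     [[1, 3, 4, 2],
      [4, 2, 1, 3],
      [2, 4, 3, 1],
      [3, 1, 2, 4]] ! (i - 1) ! (j - 1))"

lemma atLeastAtMost_1_4: "{1..4::nat} = {1, 2, 3, 4}"
  by auto

text \<open>Bounded quantifiers turn the Latin property of a concrete square into finitely many
  checks.\<close>

lemma ex1_mem_iff: "(\<exists>!x. x \<in> S \<and> P x) \<longleftrightarrow> (\<exists>x\<in>S. P x \<and> (\<forall>y\<in>S. P y \<longrightarrow> y = x))"
  by blast

lemma latin_square_self_orthogonal_4: "latin_square 4 self_orthogonal_4"
  unfolding latin_square_def ex1_mem_iff self_orthogonal_4_def cells_def atLeastAtMost_1_4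
  by (simp add: PiE_iff)

lemma self_orthogonal_4_orthogonal_s1: "orthogonal 4 self_orthogonal_4 (s1 4 self_orthogonal_4)"
  unfolding orthogonal_def self_orthogonal_4_def s1_def cells_def atLeastAtMost_1_4
  by (simp add: Sigma_def)

lemma self_orthogonal_4_neq_s1: "self_orthogonal_4 \<noteq> s1 4 self_orthogonal_4"
proof
  assume "self_orthogonal_4 = s1 4 self_orthogonal_4"
  \<comment> \<open>The entries to compare are 3 at \<open>(1, 2)\<close> and 4 at
    \<open>(2, 1)\<close>.\<close>
  then have "self_orthogonal_4 (1, 2) = s1 4 self_orthogonal_4 (1, 2)"
    by simp
  then show False
    by (simp add: self_orthogonal_4_def s1_def cells_def)
qed

theorem theorem3p5:
  "(\<forall>(n::nat) (A::array). latin_square n A \<longrightarrow>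
      (odd n \<longrightarrow> max_mols_D8 n A \<le> 4) \<and>
      (even n \<longrightarrow> max_mols_D8 n A \<le> 2 \<and>
         ((\<exists>B\<in>D8 n A. \<exists>C\<in>D8 n A. B \<noteq> C \<and> orthogonal n B C) \<longrightarrow> max_mols_D8 n A = 2))) \<and>
   (\<exists>(n::nat) (A::array). n > 0 \<and> even n \<and> latin_square n A \<and> max_mols_D8 n A = 2)"
proof -
  have le4: "max_mols_D8 n A \<le> 4" if "latin_square n A" for n A
    using that by (intro max_mols_D8_le card_le_4_if_mutually_orthogonal)
  have le2: "max_mols_D8 n A \<le> 2" if "latin_square n A" "even n" for n A
    using that by (intro max_mols_D8_le card_le_2_if_mutually_orthogonal)
  have eq2: "max_mols_D8 n A = 2"
    if "latin_square n A" "even n" "B \<in> D8 n A" "C \<in> D8 n A" "B \<noteq> C" "orthogonal n B C"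
    for n A B C
    using le2 two_le_max_mols_D8 that by (metis le_antisym)
  let ?A = self_orthogonal_4
  have "?A \<in> D8 4 ?A" "s1 4 ?A \<in> D8 4 ?A"
    using r0_eq[OF latin_square_self_orthogonal_4] by (auto simp: D8_def)
  then have "max_mols_D8 4 ?A = 2"
    using eq2[OF latin_square_self_orthogonal_4] self_orthogonal_4_neq_s1
      self_orthogonal_4_orthogonal_s1 by simp
  then have "\<exists>n A. n > 0 \<and> even n \<and> latin_square n A \<and> max_mols_D8 n A = 2"
    using latin_square_self_orthogonal_4 by (intro exI[of _ 4] exI[of _ ?A]) simp
  then show ?thesis
    using le4 le2 eq2 by blast
qed

end
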